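(* Let $k\in\mathbb{N}_0$. For $m\in\mathbb{N}_0$, $$H_k(z,-m,1)=\alpha_k\frac{\mathcal{A}_{m+2}(z)}{(1-z)^{m+3}}+(\beta_k-2\alpha_k)\frac{\mathcal{A}_{m+1}(z)}{(1-z)^{m+2}}+(1-\beta_k+\alpha_k)\frac{\mathcal{A}_m(z)}{(1-z)^{m+1}}.$$ The identity holds for $|z|<1$ and extends as a rational identity for $z\neq1$ (that is, with $H_k(z,-m,1)$ for $z\ne 1$ denoting the rational function of $z$ extending its values on $|z|<1$).
   Context: $\mathbb{N}_0=\{0,1,2,\ldots\}$. $\alpha_k=\frac32 4^k$, $\beta_k=\frac32 2^k$, and the $k$-augmented centered triangular numbers are given by $A(r+1,k)=\alpha_k r^2+\beta_k r+1$ for integers $r\ge0$. $H_k(z,s,a)=\sum_{r=0}^{\infty}\frac{A(r+1,k)z^r}{(r+a)^s}$, so for $|z|<1$, $H_k(z,-m,1)=\sum_{r=0}^\infty A(r+1,k)(r+1)^m z^r$. $\mathcal{A}_n(z)$ is the Eulerian polynomial: $\mathcal{A}_0(z)=1$ and $\mathcal{A}_n(z)=\sum_{j=0}^{n-1}\left\langle {n\atop j}\right\rangle z^j$ for $n\ge1$, where $\left\langle {n\atop j}\right\rangle$ is the Eulerian number (the number of permutations of $\{1,\dots,n\}$ with exactly $j$ descents). *)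

theory Defs
  imports
    "HOL-Analysis.Analysis"
    "HOL-Combinatorics.Permutations"
    "HOL-Computational_Algebra.Polynomial"
begin

definition alpha :: "nat \<Rightarrow> real" where
  "alpha k = 3 / 2 * 4 ^ k"

definition beta :: "nat \<Rightarrow> real" where
  "beta k = 3 / 2 * 2 ^ k"

(* Meant for n >= 1: A(r+1,k) = alpha_k r^2 + beta_k r + 1 with n = r + 1. *)
definition aug_tri :: "nat \<Rightarrow> nat \<Rightarrow> real" where
  "aug_tri n k = alpha k * (real n - 1) ^ 2 + beta k * (real n - 1) + 1"

(* (r + a)^s is the principal power, so the term is the intended one as long as
   a is not a non-positive integer. *)
definition H_term :: "nat \<Rightarrow> complex \<Rightarrow> complex \<Rightarrow> complex \<Rightarrow> nat \<Rightarrow> complex" where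
  "H_term k z s a r = of_real (aug_tri (r + 1) k) * z ^ r / (of_nat r + a) powr s"

definition H :: "nat \<Rightarrow> complex \<Rightarrow> complex \<Rightarrow> complex \<Rightarrow> complex" where
  "H k z s a = (\<Sum>r. H_term k z s a r)"

definition descents :: "nat \<Rightarrow> (nat \<Rightarrow> nat) \<Rightarrow> nat set" where
  "descents n p = {i \<in> {1..<n}. p i > p (i + 1)}"

definition eulerian_number :: "nat \<Rightarrow> nat \<Rightarrow> nat" where
  "eulerian_number n j = card {p. p permutes {1..n} \<and> card (descents n p) = j}"

definition eulerian_poly :: "nat \<Rightarrow> complex poly" where
  "eulerian_poly n =
     (if n = 0 then 1 else (\<Sum>j<n. monom (of_nat (eulerian_number n j)) j))"

definition rational_function_on :: "complex set \<Rightarrow> (complex \<Rightarrow> complex) \<Rightarrow> bool" where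
  "rational_function_on S F \<longleftrightarrow>
     (\<exists>p q. \<forall>z\<in>S. poly q z \<noteq> 0 \<and> F z = poly p z / poly q z)"

(* F is a rational function, regular off 1, that extends z \<mapsto> H k z (-m) 1 from the
   unit disc. Its value at 1 is irrelevant. *)
definition rational_extension_H :: "nat \<Rightarrow> nat \<Rightarrow> (complex \<Rightarrow> complex) \<Rightarrow> bool" where
  "rational_extension_H k m F \<longleftrightarrow>
     rational_function_on (- {1}) F \<and>
     (\<forall>z. norm z < 1 \<longrightarrow> F z = H k z (- of_nat m) 1)"

end

theory Submission
  imports Defs "HOL-Combinatorics.Multiset_Permutations"
begin

text \<open>
  Writing \<open>R = r + 1\<close>, the coefficient \<open>A(R, k)\<close> is the quadratic polynomial
  \<open>\<alpha> R\<^sup>2 + (\<beta> - 2\<alpha>) R + (1 - \<beta> + \<alpha>)\<close>, so the series is a linear combination of the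
  generating functions \<open>\<Sum>r. (r + 1)\<^sup>n z\<^sup>r\<close> for \<open>n = m + 2, m + 1, m\<close>. Everything therefore rests
  on Euler's identity that this generating function is \<open>A\<^sub>n(z) / (1 - z)\<^sup>n\<^sup>+\<^sup>1\<close>
  (\<open>sums_eulerian\<close>).

  Since the Eulerian numbers are defined by counting descents, the identity needs the bridge
  \<open>A\<^sub>n\<^sub>+\<^sub>1 = (1 + n X) A\<^sub>n + X (1 - X) A\<^sub>n'\<close> (\<open>eulerian_poly_Suc\<close>). It comes from building the
  permutations of \<open>{1..n+1}\<close>, written as words, by inserting \<open>n + 1\<close> into the permutations of
  \<open>{1..n}\<close>. If \<open>w\<close> has \<open>d\<close> descents, then \<open>d + 1\<close> of the \<open>n + 1\<close> positions leave that number
  unchanged (the last position and the \<open>d\<close> positions inside a descent), and the other \<open>n - d\<close>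
  raise it by one (\<open>sum_des_insert_max\<close>). On the side of the series, passing from \<open>n\<close> to
  \<open>n + 1\<close> is the operator \<open>f \<mapsto> (z f)'\<close>, and by the quotient rule this operator acts on
  \<open>A\<^sub>n(z) / (1 - z)\<^sup>n\<^sup>+\<^sup>1\<close> exactly through that recurrence.

  The extension to all \<open>z \<noteq> 1\<close> is uniqueness: cross-multiplying two rational functions that
  agree on the unit disc gives two polynomials that agree at infinitely many points
  (\<open>rational_functions_eq_if_eq_on_infinite\<close>).
\<close>

section \<open>Inserting a new maximum into a word\<close>

fun des :: "'a::linorder list \<Rightarrow> nat" where
  "des [] = 0"
| "des [x] = 0"
| "des (x # y # w) = (if x > y then 1 else 0) + des (y # w)"

text \<open>
  Relates the recursion, which suits insertion, to the set of descent positions by which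
  the Eulerian numbers are defined.
\<close>

lemma des_map_upt: "des (map f [a..<b]) = card {i. a \<le> i \<and> Suc i < b \<and> f i > f (Suc i)}"
proof (induction "b - a" arbitrary: a)
  case 0
  then have "{i. a \<le> i \<and> Suc i < b \<and> f i > f (Suc i)} = {}" by auto
  then show ?case using 0 by (simp only: card.empty) simp
next
  case (Suc l)
  let ?D = "\<lambda>a. {i. a \<le> i \<and> Suc i < b \<and> f i > f (Suc i)}"
  show ?case
  proof (cases "Suc a < b")
    case False
    then have "?D a = {}" by auto
    moreover have "[a..<b] = [a]"
      using False Suc.hyps(2) by (simp add: upt_conv_Cons)
    ultimately show ?thesis by (simp only: card.empty) simp
  next
    case True
    have fin: "finite (?D (Suc a))" by (rule finite_subset[of _ "{..<b}"]) auto
    have "?D a = (if f a > f (Suc a) then insert a (?D (Suc a)) else ?D (Suc a))"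
      using True by (auto simp: Suc_le_eq) (metis le_neq_implies_less)+
    then have "card (?D a) = (if f a > f (Suc a) then 1 else 0) + card (?D (Suc a))"
      using fin by simp
    moreover have "des (map f [Suc a..<b]) = card (?D (Suc a))"
      using Suc by simp
    moreover have "[a..<b] = a # Suc a # [Suc (Suc a)..<b]" "[Suc a..<b] = Suc a # [Suc (Suc a)..<b]"
      using True by (simp_all add: upt_conv_Cons)
    ultimately show ?thesis by simp
  qed
qed

definition insert_at :: "nat \<Rightarrow> 'a \<Rightarrow> 'a list \<Rightarrow> 'a list" where
  "insert_at i x w = take i w @ x # drop i w"

lemma insert_at_0 [simp]: "insert_at 0 x w = x # w"
  by (simp add: insert_at_def)

lemma insert_at_Suc_Cons [simp]: "insert_at (Suc i) x (y # w) = y # insert_at i x w"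
  by (simp add: insert_at_def)

text \<open>
  Insertion at a positive position keeps the first letter, so prepending \<open>x\<close> contributes the
  same descent as it did before the insertion.
\<close>

lemma des_Cons_insert_at_Suc:
  "des (x # insert_at (Suc i) N (y # w))
     = (if x > y then 1 else 0) + des (insert_at (Suc i) N (y # w))"
  by simp

text \<open>
  The front position is left out because insertion there changes the first letter, and then the
  descent contributed by prepending \<open>x\<close> would depend on the position; without it, the
  contribution is a common factor and induction on the word works.
\<close>

lemma sum_des_insert_max_after_first:
  fixes z :: "'b::comm_ring_1" and N :: "'a::linorder"
  assumes "\<forall>x\<in>set w. x < N" and "w \<noteq> []"
  shows "(\<Sum>i<length w. z ^ des (insert_at (Suc i) N w))
           = (of_nat (des w) + 1) * z ^ des w
             + (of_nat (length w) - 1 - of_nat (des w)) * z ^ Suc (des w)"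
  using assms
proof (induction w rule: des.induct)
  case (3 x y w)
  let ?e = "if x > y then 1 else 0 :: nat"
  \<comment> \<open>Insertion between \<open>x\<close> and \<open>y\<close> is the front position of \<open>y # w\<close>; it always ends
    with \<open>N > y\<close> as a descent and has none at \<open>x\<close>.\<close>
  have "(\<Sum>i<length (x # y # w). z ^ des (insert_at (Suc i) N (x # y # w)))
      = z ^ des (x # N # y # w)
        + (\<Sum>i<length (y # w). z ^ des (x # insert_at (Suc i) N (y # w)))"
    by (simp only: length_Cons sum.lessThan_Suc_shift insert_at_Suc_Cons insert_at_0)
  also have "des (x # N # y # w) = Suc (des (y # w))"
    using "3.prems" by auto
  also have "(\<Sum>i<length (y # w). z ^ des (x # insert_at (Suc i) N (y # w)))
      = z ^ ?e * (\<Sum>i<length (y # w). z ^ des (insert_at (Suc i) N (y # w)))"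
    by (simp only: des_Cons_insert_at_Suc power_add sum_distrib_left)
  also have "(\<Sum>i<length (y # w). z ^ des (insert_at (Suc i) N (y # w)))
      = (of_nat (des (y # w)) + 1) * z ^ des (y # w)
        + (of_nat (length (y # w)) - 1 - of_nat (des (y # w))) * z ^ Suc (des (y # w))"
    using "3.prems" by (intro "3.IH") auto
  finally show ?case
    by (simp only:) (simp add: algebra_simps)
qed auto

text \<open>
  With the front position included, \<open>d + 1\<close> positions preserve the number \<open>d\<close> of descents: the
  end of the word and the inside of each descent, where the old descent is replaced by the one
  after \<open>N\<close>. All other positions create one new descent.
\<close>

lemma sum_des_insert_max:
  fixes z :: "'b::comm_ring_1" and N :: "'a::linorder"
  assumes "\<forall>x\<in>set w. x < N"
  shows "(\<Sum>i\<le>length w. z ^ des (insert_at i N w))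
           = (of_nat (des w) + 1) * z ^ des w
             + (of_nat (length w) - of_nat (des w)) * z ^ Suc (des w)"
proof (cases w)
  case (Cons x v)
  have "(\<Sum>i\<le>length w. z ^ des (insert_at i N w))
      = z ^ des (N # w) + (\<Sum>i<length w. z ^ des (insert_at (Suc i) N w))"
    by (simp add: sum.lessThan_Suc_shift flip: lessThan_Suc_atMost del: sum.lessThan_Suc)
  also have "des (N # w) = Suc (des w)"
    using assms Cons by simp
  finally show ?thesis
    using sum_des_insert_max_after_first[OF assms, of z] Cons by (simp add: algebra_simps)
qed simp

section \<open>The Eulerian polynomials\<close>

text \<open>
  A permutation of \<open>insert N A\<close> determines, and is determined by, the word obtained by erasing
  \<open>N\<close> together with the number of letters that preceded \<open>N\<close>.
\<close>

lemma sum_permutations_of_set_insert: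
  assumes "finite A" and "N \<notin> A"
  shows "sum f (permutations_of_set (insert N A))
           = (\<Sum>w\<in>permutations_of_set A. \<Sum>i\<le>card A. f (insert_at i N w))"
proof -
  have "(\<Sum>w\<in>permutations_of_set A. \<Sum>i\<le>card A. f (insert_at i N w))
      = (\<Sum>(w, i)\<in>permutations_of_set A \<times> {..card A}. f (insert_at i N w))"
    by (simp add: sum.cartesian_product)
  also have "\<dots> = sum f (permutations_of_set (insert N A))"
  proof (rule sum.reindex_bij_witness[where
        i = "\<lambda>v. (remove1 N v, length (takeWhile (\<lambda>x. x \<noteq> N) v))"
        and j = "\<lambda>(w, i). insert_at i N w"], goal_cases)
    case (1 a)
    obtain w i where a: "a = (w, i)" by (cases a)
    with 1 have w: "set w = A" "distinct w" "i \<le> length w"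
      by (auto dest: permutations_of_setD simp: distinct_card[symmetric] permutations_of_set_def)
    have N: "N \<notin> set w" "N \<notin> set (take i w)"
      using w assms by (auto dest: in_set_takeD)
    have "remove1 N (insert_at i N w) = w"
      using N by (simp add: insert_at_def remove1_append)
    moreover have "takeWhile (\<lambda>x. x \<noteq> N) (insert_at i N w) = take i w"
      using N by (auto simp: insert_at_def takeWhile_tail intro: takeWhile_append2[THEN trans])
    ultimately show ?case using a w by simp
  next
    case (2 a)
    obtain w i where a: "a = (w, i)" by (cases a)
    with 2 have w: "set w = A" "distinct w"
      by (auto dest: permutations_of_setD)
    have "mset w = mset (take i w) + mset (drop i w)"
      by (metis append_take_drop_id mset_append)
    then have "mset (insert_at i N w) = add_mset N (mset w)"
      by (simp add: insert_at_def)
    then have "set (insert_at i N w) = insert N A" "distinct (insert_at i N w)"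
      using w assms by (metis set_mset_add_mset_insert set_mset_mset,
          metis distinct.simps(2) mset.simps(2) mset_eq_imp_distinct_iff)
    then show ?case using a by auto
  next
    case (3 v)
    then have v: "set v = insert N A" "distinct v"
      by (auto dest: permutations_of_setD)
    then obtain xs ys where s: "v = xs @ N # ys" "N \<notin> set xs"
      by (metis insertI1 split_list_first)
    have "takeWhile (\<lambda>x. x \<noteq> N) v = xs"
      using s by (auto intro: takeWhile_append2[THEN trans])
    then show ?case
      using s by (simp add: insert_at_def remove1_append)
  next
    case (4 v)
    then have v: "set v = insert N A" "distinct v"
      by (auto dest: permutations_of_setD)
    then obtain xs ys where s: "v = xs @ N # ys" "N \<notin> set xs"
      by (metis insertI1 split_list_first)
    have r: "remove1 N v = xs @ ys" and l: "takeWhile (\<lambda>x. x \<noteq> N) v = xs"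
      using s by (auto simp: remove1_append intro: takeWhile_append2[THEN trans])
    have A: "set (xs @ ys) = A" "distinct (xs @ ys)"
      using v s assms by auto
    have "card A = length xs + length ys"
      using A distinct_card by fastforce
    then show ?case using r l A by auto
  qed auto
  finally show ?thesis by simp
qed

text \<open>
  Passage from permutations as functions to one-line notation. Injectivity is the part to check;
  surjectivity follows because both sides have \<open>n!\<close> elements.
\<close>

lemma sum_permutes_word:
  "(\<Sum>p | p permutes {1..n}. f (map p [1..<Suc n])) = sum f (permutations_of_set {1..n})"
proof -
  let ?P = "{p. p permutes {1..n}}" and ?g = "\<lambda>p. map p [1..<Suc n]"
  have inj: "inj_on ?g ?P"
  proof (rule inj_onI)
    fix p q assume "p \<in> ?P" "q \<in> ?P" and eq: "?g p = ?g q"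
    then have p: "p permutes {1..n}" and q: "q permutes {1..n}" by auto
    show "p = q"
    proof
      fix i show "p i = q i"
      proof (cases "i \<in> {1..n}")
        case True
        then show ?thesis using eq by (auto simp del: upt_Suc)
      next
        case False
        then show ?thesis using p q by (metis permutes_not_in)
      qed
    qed
  qed
  have "?g ` ?P \<subseteq> permutations_of_set {1..n}"
  proof safe
    fix p assume p: "p permutes {1..n}"
    have "set (?g p) = {1..n}"
      using permutes_image[OF p] by (simp add: atLeastLessThanSuc_atLeastAtMost del: upt_Suc)
    moreover have "distinct (?g p)"
      using permutes_inj_on[OF p] by (simp add: distinct_map del: upt_Suc)
    ultimately show "?g p \<in> permutations_of_set {1..n}" by blast
  qed
  moreover have "card (?g ` ?P) = card (permutations_of_set {1..n})"
    using card_image[OF inj] by (simp add: card_permutations)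
  ultimately have "?g ` ?P = permutations_of_set {1..n}"
    by (intro card_subset_eq) auto
  then show ?thesis
    using sum.reindex[OF inj, of f] by simp
qed

lemma descents_eq_des: "card (descents n p) = des (map p [1..<Suc n])"
  unfolding des_map_upt descents_def by (rule arg_cong[where f = card]) auto

lemma eulerian_poly_eq_sum_words:
  "eulerian_poly n = (\<Sum>w\<in>permutations_of_set {1..n}. [:0, 1:] ^ des w)"
proof (cases "n = 0")
  case True
  then show ?thesis by (simp add: eulerian_poly_def)
next
  case False
  let ?P = "{p. p permutes {1..n}}"
  have fin: "finite ?P" by (simp add: finite_permutations)
  have "card (descents n p) < n" for p
  proof -
    have "card (descents n p) \<le> card {1..<n}"
      by (rule card_mono) (auto simp: descents_def)
    then show ?thesis using False by simp
  qed
  then have sub: "(\<lambda>p. card (descents n p)) ` ?P \<subseteq> {..<n}" by auto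
  have "(\<Sum>j<n. monom (of_nat (eulerian_number n j)) j)
      = (\<Sum>j<n. \<Sum>p\<in>{p\<in>?P. card (descents n p) = j}. monom (1::complex) (card (descents n p)))"
  proof (rule sum.cong)
    fix j
    have "(\<Sum>p\<in>{p\<in>?P. card (descents n p) = j}. monom (1::complex) (card (descents n p)))
        = (\<Sum>p\<in>{p\<in>?P. card (descents n p) = j}. monom 1 j)"
      by (rule sum.cong) auto
    then show "monom (of_nat (eulerian_number n j)) j
        = (\<Sum>p\<in>{p\<in>?P. card (descents n p) = j}. monom (1::complex) (card (descents n p)))"
      by (simp add: eulerian_number_def of_nat_poly smult_monom)
  qed simp
  also have "\<dots> = (\<Sum>p\<in>?P. monom 1 (card (descents n p)))"
    by (rule sum.group[OF fin _ sub]) simp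
  also have "\<dots> = (\<Sum>p\<in>?P. [:0, 1:] ^ des (map p [1..<Suc n]))"
    by (simp only: descents_eq_des monom_altdef smult_1_left)
  finally show ?thesis
    using False sum_permutes_word[where f = "\<lambda>w. [:0, 1 :: complex:] ^ des w"]
    by (simp add: eulerian_poly_def del: upt_Suc)
qed

text \<open>
  Summing the insertion count over all words: multiplication of \<open>X\<^sup>d\<close> by \<open>d\<close> is the operator
  \<open>X\<close> times differentiation, so
  \<open>(d + 1) X\<^sup>d + (n - d) X\<^sup>d\<^sup>+\<^sup>1 = (1 + n X) X\<^sup>d + (1 - X) (X (X\<^sup>d)')\<close>.
\<close>

lemma eulerian_poly_Suc:
  "eulerian_poly (Suc n)
     = (1 + of_nat n * [:0, 1:]) * eulerian_poly n
       + [:0, 1:] * (1 - [:0, 1:]) * pderiv (eulerian_poly n)"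
proof -
  let ?X = "[:0, 1:] :: complex poly" and ?P = "permutations_of_set {1..n}"
  have pd: "?X * pderiv (?X ^ d) = of_nat d * ?X ^ d" for d
  proof -
    have "?X ^ d = monom 1 d" by (simp add: monom_altdef)
    then show ?thesis
      by (cases d) (simp_all add: pderiv_monom of_nat_poly smult_monom flip: monom_Suc)
  qed
  have pderiv_sum: "pderiv (sum f A) = (\<Sum>w\<in>A. pderiv (f w))"
    for f :: "nat list \<Rightarrow> complex poly" and A
    using higher_pderiv_sum[of 1 f A] by simp
  have ring: "(d + 1) * P + (a - d) * (X * P) = (1 + a * X) * P + (1 - X) * (d * P)"
    for a d P X :: "complex poly"
    by (simp add: algebra_simps)
  have "{1..Suc n} = insert (Suc n) {1..n}" by auto
  then have "eulerian_poly (Suc n)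
      = (\<Sum>w\<in>?P. \<Sum>i\<le>n. ?X ^ des (insert_at i (Suc n) w))"
    by (simp add: eulerian_poly_eq_sum_words sum_permutations_of_set_insert)
  also have "\<dots> = (\<Sum>w\<in>?P. (1 + of_nat n * ?X) * ?X ^ des w
                    + (1 - ?X) * (?X * pderiv (?X ^ des w)))"
  proof (rule sum.cong)
    fix w assume w: "w \<in> ?P"
    then have "length w = n"
      using length_finite_permutations_of_set by fastforce
    moreover have "\<forall>x\<in>set w. x < Suc n"
      using w by (auto dest: permutations_of_setD)
    ultimately show "(\<Sum>i\<le>n. ?X ^ des (insert_at i (Suc n) w))
        = (1 + of_nat n * ?X) * ?X ^ des w + (1 - ?X) * (?X * pderiv (?X ^ des w))"
      using sum_des_insert_max[of w "Suc n" ?X] unfolding pd by (simp only: power_Suc ring)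
  qed simp
  also have "\<dots> = (1 + of_nat n * ?X) * eulerian_poly n
      + ?X * (1 - ?X) * pderiv (eulerian_poly n)"
    by (simp only: eulerian_poly_eq_sum_words sum.distrib sum_distrib_left
          pderiv_sum mult_ac)
  finally show ?thesis .
qed

lemma poly_eulerian_poly_Suc:
  "poly (eulerian_poly (Suc n)) z
     = (1 + of_nat n * z) * poly (eulerian_poly n) z
       + z * (1 - z) * poly (pderiv (eulerian_poly n)) z"
  by (simp add: eulerian_poly_Suc of_nat_poly algebra_simps)

section \<open>The generating function of the powers\<close>

text \<open>
  Induction on \<open>n\<close>, starting from the geometric series. The step differentiates
  \<open>\<Sum>r. r\<^sup>n z\<^sup>r\<close> term by term, which yields \<open>\<Sum>r. (r + 1)\<^sup>n\<^sup>+\<^sup>1 z\<^sup>r\<close>.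
\<close>

lemma sums_eulerian:
  fixes z :: complex
  assumes "norm z < 1"
  shows "(\<lambda>r. of_nat (r + 1) ^ n * z ^ r) sums (poly (eulerian_poly n) z / (1 - z) ^ (n + 1))"
  using assms
proof (induction n arbitrary: z)
  case 0
  then show ?case using geometric_sums[of z] by (simp add: eulerian_poly_def)
next
  case (Suc n)
  \<comment> \<open>The term \<open>?c 0\<close> is 1 for \<open>n = 0\<close> and 0 otherwise; being constant,
    it disappears on differentiation.\<close>
  let ?c = "\<lambda>r. of_nat r ^ n :: complex" and ?A = "eulerian_poly n"
  let ?G = "\<lambda>z. ?c 0 + z * (poly ?A z / (1 - z) ^ (n + 1))"
  have sums: "(\<lambda>r. ?c r * x ^ r) sums ?G x" if "norm x < 1" for x
  proof -
    have "(\<lambda>r. ?c (Suc r) * x ^ Suc r) sums (x * (poly ?A x / (1 - x) ^ (n + 1)))"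
      using sums_mult[OF Suc.IH[OF that], of x] by (simp add: mult_ac)
    from sums_Suc[OF this] show ?thesis by (simp add: add.commute)
  qed
  have z1: "1 - z \<noteq> 0" using Suc.prems by auto
  have deriv_series:
    "((\<lambda>x. \<Sum>r. ?c r * x ^ r) has_field_derivative (\<Sum>r. diffs ?c r * z ^ r)) (at z)"
    using sums Suc.prems by (intro termdiffs_strong'[where K = 1]) (auto simp: sums_iff)
  \<comment> \<open>To be used with \<open>w = 1 - z\<close>, \<open>P = (1 - z)\<^sup>n\<close> and \<open>N = n\<close>, where \<open>w + z = 1\<close> turns the
    right-hand numerator into the recurrence for the Eulerian polynomials.\<close>
  have quotient: "A / (w * P) + z * ((B * (w * P) + A * ((1 + N) * P)) / (w * P)\<^sup>2)
      = ((w + z + N * z) * A + z * w * B) / (w * (w * P))"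
    if "w \<noteq> 0" "P \<noteq> 0" for w P A z B N :: complex
    using that by (simp add: divide_simps power2_eq_square) (simp add: algebra_simps)
  have pow: "((\<lambda>x. (1 - x) ^ (n + 1)) has_field_derivative
      - (of_nat (n + 1) * (1 - z) ^ n)) (at z)"
    unfolding Suc_eq_plus1[symmetric]
    by (rule DERIV_cong[OF DERIV_power_Suc[OF DERIV_diff[OF DERIV_const DERIV_ident]]]) simp
  have "(?G has_field_derivative
      (poly ?A z / (1 - z) ^ (n + 1)
        + z * ((poly (pderiv ?A) z * (1 - z) ^ (n + 1)
                + poly ?A z * (of_nat (n + 1) * (1 - z) ^ n)) / ((1 - z) ^ (n + 1))\<^sup>2))) (at z)"
  proof (rule DERIV_cong[OF DERIV_add[OF DERIV_const
        DERIV_mult[OF DERIV_ident DERIV_divide[OF poly_DERIV pow]]]])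
  qed (use z1 in \<open>simp_all add: power2_eq_square\<close>)
  then have "((\<lambda>x. \<Sum>r. ?c r * x ^ r) has_field_derivative
      (poly ?A z / (1 - z) ^ (n + 1)
        + z * ((poly (pderiv ?A) z * (1 - z) ^ (n + 1)
                + poly ?A z * (of_nat (n + 1) * (1 - z) ^ n)) / ((1 - z) ^ (n + 1))\<^sup>2))) (at z)"
    by (rule has_field_derivative_transform_within_open[where S = "ball 0 1"])
      (use sums Suc.prems in \<open>auto simp: sums_iff\<close>)
  from DERIV_unique[OF deriv_series this]
  have "(\<Sum>r. diffs ?c r * z ^ r) = poly (eulerian_poly (Suc n)) z / (1 - z) ^ (Suc n + 1)"
    using quotient[OF z1, of "(1 - z) ^ n" "poly ?A z" z "poly (pderiv ?A) z" "of_nat n"] z1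
    by (simp add: poly_eulerian_poly_Suc)
  moreover have "summable (\<lambda>r. diffs ?c r * z ^ r)"
    using sums Suc.prems by (intro termdiff_converges[where K = 1]) (auto simp: sums_iff)
  moreover have "diffs ?c r = of_nat (r + 1) ^ Suc n" for r
    by (simp add: diffs_def)
  ultimately show ?case by (simp add: sums_iff)
qed

section \<open>Rational functions\<close>

text \<open>
  For \<open>F = p/q\<close> and \<open>G = a/b\<close>, the polynomial \<open>p b - a q\<close> has infinitely many roots, hence
  vanishes, and the denominators can be divided out again anywhere on \<open>S\<close>.
\<close>

lemma rational_functions_eq_if_eq_on_infinite:
  assumes F: "rational_function_on S F" and G: "rational_function_on S G"
    and T: "infinite T" "T \<subseteq> S" and eq: "\<And>z. z \<in> T \<Longrightarrow> F z = G z"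
    and z: "z \<in> S"
  shows "F z = G z"
proof -
  obtain p q where pq: "\<And>z. z \<in> S \<Longrightarrow> poly q z \<noteq> 0 \<and> F z = poly p z / poly q z"
    using F unfolding rational_function_on_def by metis
  obtain a b where ab: "\<And>z. z \<in> S \<Longrightarrow> poly b z \<noteq> 0 \<and> G z = poly a z / poly b z"
    using G unfolding rational_function_on_def by metis
  have "T \<subseteq> {z. poly (p * b - a * q) z = 0}"
  proof
    fix x assume x: "x \<in> T"
    then have "x \<in> S" using T by auto
    then show "x \<in> {z. poly (p * b - a * q) z = 0}"
      using pq[of x] ab[of x] eq[OF x] by (auto simp: frac_eq_eq)
  qed
  then have "p * b - a * q = 0"
    using T(1) poly_roots_finite finite_subset by blast
  then have "poly (p * b) z = poly (a * q) z" by simp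
  then show ?thesis
    using pq[OF z] ab[OF z] by (simp add: frac_eq_eq)
qed

lemma rational_function_on_add:
  assumes "rational_function_on S F" and "rational_function_on S G"
  shows "rational_function_on S (\<lambda>z. F z + G z)"
proof -
  obtain p q where pq: "\<And>z. z \<in> S \<Longrightarrow> poly q z \<noteq> 0 \<and> F z = poly p z / poly q z"
    using assms(1) unfolding rational_function_on_def by metis
  obtain a b where ab: "\<And>z. z \<in> S \<Longrightarrow> poly b z \<noteq> 0 \<and> G z = poly a z / poly b z"
    using assms(2) unfolding rational_function_on_def by metis
  have "poly (q * b) z \<noteq> 0 \<and> F z + G z = poly (p * b + a * q) z / poly (q * b) z"
    if "z \<in> S" for z
    using pq[OF that] ab[OF that] by (simp add: add_frac_eq)
  then show ?thesis unfolding rational_function_on_def by blast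
qed

lemma rational_function_on_pole_at_1:
  "rational_function_on (- {1}) (\<lambda>z. c * (poly p z / (1 - z) ^ n))"
  unfolding rational_function_on_def
  by (rule exI[of _ "smult c p"], rule exI[of _ "[:1, -1:] ^ n"]) (auto simp: poly_power)

theorem theorem7p8:
  fixes k m :: nat
  shows
    "(\<forall>z. norm z < 1 \<longrightarrow>
        summable (H_term k z (- of_nat m) 1) \<and>
        H k z (- of_nat m) 1 =
          of_real (alpha k) * (poly (eulerian_poly (m + 2)) z / (1 - z) ^ (m + 3))
          + of_real (beta k - 2 * alpha k) * (poly (eulerian_poly (m + 1)) z / (1 - z) ^ (m + 2))
          + of_real (1 - beta k + alpha k) * (poly (eulerian_poly m) z / (1 - z) ^ (m + 1)))
     \<and> (\<exists>F. rational_extension_H k m F)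
     \<and> (\<forall>F. rational_extension_H k m F \<longrightarrow>
        (\<forall>z. z \<noteq> 1 \<longrightarrow>
          F z =
            of_real (alpha k) * (poly (eulerian_poly (m + 2)) z / (1 - z) ^ (m + 3))
            + of_real (beta k - 2 * alpha k) * (poly (eulerian_poly (m + 1)) z / (1 - z) ^ (m + 2))
            + of_real (1 - beta k + alpha k) * (poly (eulerian_poly m) z / (1 - z) ^ (m + 1))))"
proof -
  let ?R = "\<lambda>z. of_real (alpha k) * (poly (eulerian_poly (m + 2)) z / (1 - z) ^ (m + 3))
          + of_real (beta k - 2 * alpha k) * (poly (eulerian_poly (m + 1)) z / (1 - z) ^ (m + 2))
          + of_real (1 - beta k + alpha k) * (poly (eulerian_poly m) z / (1 - z) ^ (m + 1))"
  \<comment> \<open>The quadratic in \<open>r\<close> re-expanded in powers of \<open>r + 1\<close>.\<close>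
  have term_eq: "H_term k z (- of_nat m) 1 r
      = of_real (alpha k) * (of_nat (r + 1) ^ (m + 2) * z ^ r)
        + of_real (beta k - 2 * alpha k) * (of_nat (r + 1) ^ (m + 1) * z ^ r)
        + of_real (1 - beta k + alpha k) * (of_nat (r + 1) ^ m * z ^ r)" for z r
  proof -
    have nz: "of_nat r + 1 \<noteq> (0 :: complex)"
      by (metis of_nat_Suc of_nat_neq_0 add.commute)
    then have "1 / (of_nat r + 1 :: complex) powr (- of_nat m) = (of_nat r + 1) ^ m"
      by (simp add: powr_minus powr_nat' inverse_eq_divide)
    then have "H_term k z (- of_nat m) 1 r
        = of_real (aug_tri (r + 1) k) * z ^ r * (of_nat r + 1) ^ m"
      unfolding H_term_def by (metis divide_inverse inverse_eq_divide mult.assoc)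
    then show ?thesis
      by (simp add: aug_tri_def algebra_simps power2_eq_square)
  qed
  have sums: "H_term k z (- of_nat m) 1 sums ?R z" if "norm z < 1" for z
  proof -
    have "m + 2 + 1 = m + 3" "m + 1 + 1 = m + 2" by simp_all
    then show ?thesis
      unfolding term_eq using sums_eulerian[OF that]
      by (intro sums_add sums_mult) metis+
  qed
  have rat: "rational_function_on (- {1}) ?R"
    by (intro rational_function_on_add rational_function_on_pole_at_1)
  have "rational_extension_H k m ?R"
    unfolding rational_extension_H_def H_def using rat sums by (simp add: sums_iff)
  moreover have "F z = ?R z" if F: "rational_extension_H k m F" and "z \<noteq> 1" for F z
  proof (rule rational_functions_eq_if_eq_on_infinite[where S = "- {1}" and G = ?R and T = "ball 0 1"])
    show "rational_function_on (- {1}) F"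
      using F by (simp add: rational_extension_H_def)
    show "infinite (ball 0 1 :: complex set)"
      using finite_imp_not_open[of "ball 0 1 :: complex set"] by auto
    show "F x = ?R x" if "x \<in> ball 0 1" for x
      using F sums[of x] that by (simp add: rational_extension_H_def H_def sums_iff)
  qed (use rat that in auto)
  ultimately show ?thesis
    using sums unfolding H_def by (auto simp: sums_iff)
qed

end
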